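(* In $\widehat{\mathbb{R}}$ the following rules hold. a) If $x,y\in\widehat{\mathbb{R}}$, then $d(x+y)=dx+dy$ and $d(x-y)=dx-dy$. b) If $x,y\in\widehat{\mathbb{R}}$, then $d(xy)=(\sigma x)dy+(\sigma y)dx=x\,dy+y\,dx$. In particular, $d(\xi x)=\xi\,dx$ for each $\xi\in\mathbb{R}$. c) If $m\in\mathbb{N}$ and $x\in\widehat{\mathbb{R}}$, then $d(x^m)=m(\sigma x)^{m-1}dx=mx^{m-1}dx$. d) If $x\in\widehat{\mathbb{R}}$ and $x$ is not an infinitesimal, then $d\left(\frac1x\right)=-\frac{1}{(\sigma x)^2}dx=-\frac{1}{x^2}dx$. e) If $x,y\in\widehat{\mathbb{R}}$ and $x$ is not an infinitesimal, then $d\left(\frac yx\right)=\frac{(\sigma x)dy-(\sigma y)dx}{(\sigma x)^2}=\frac{x\,dy-y\,dx}{x^2}$. f) If $x\in\widehat{\mathbb{R}}^{+}$, $m\in\mathbb{N}$ and $m>1$, then $d(\sqrt[m]{x})=\frac{1}{m\sqrt[m]{(\sigma x)^{m-1}}}dx=\frac{1}{m\sqrt[m]{x^{m-1}}}dx$.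
   Context: $\widehat{\mathbb{R}}$ is the set of all convergent sequences of real numbers; a real number is identified with the corresponding constant sequence, so $\mathbb{R}\subseteq\widehat{\mathbb{R}}$. The shadow $\sigma x\in\mathbb{R}$ is the limit of $x$. An infinitesimal is an $x$ with $\sigma x=0$. The differential is $dx:=x-\sigma x$, the unique infinitesimal with $x=\sigma x+dx$. For $x=(\xi_n),y=(\eta_n)$: $x+y:=(\xi_n+\eta_n)$, $xy:=(\sigma x\,\eta_n+\sigma y\,\xi_n-\sigma x\,\sigma y)$; with these operations $\widehat{\mathbb{R}}$ is a commutative ring with identity $1$ in which the invertible elements are exactly the non-infinitesimals; $\frac1x$ is the multiplicative inverse and $\frac yx:=y\cdot\frac1x$; $x^m$ is the $m$-th power in this ring and $x^0:=1$. Order: $x<y$ iff $\sigma x<\sigma y$; $\widehat{\mathbb{R}}^{+}:=\{x\in\widehat{\mathbb{R}}\mid x>0\}$. For $x\in\widehat{\mathbb{R}}^{+}$ and $m>1$, $\sqrt[m]{x}$ is the unique $y\in\widehat{\mathbb{R}}^{+}$ with $y^m=x$ (for real $x$ this is the usual positive root). $\mathbb{N}$ is the set of positive integers. *)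

theory Defs
  imports Complex_Main
begin

text \<open>The ring of convergent real sequences with the truncated ("first-order") product.
  Sequences are indexed from 0.\<close>

typedef hatreal = "{x :: nat \<Rightarrow> real. convergent x}"
  morphisms terms Abs_hatreal
  by (auto intro: convergent_const)

setup_lifting type_definition_hatreal

lift_definition shadow :: "hatreal \<Rightarrow> real" is lim .

text \<open>The inclusion of the reals; the identification of a real number with a constant
  sequence is made explicit by this map.\<close>

lift_definition const :: "real \<Rightarrow> hatreal" is "\<lambda>r _. r"
  by (rule convergent_const)

lemma terms_tendsto: "terms x \<longlonglongrightarrow> shadow x"
  by transfer (simp add: convergent_LIMSEQ_iff)

lemma shadow_eqI:
  assumes "\<And>n. terms x n = f n" and "f \<longlonglongrightarrow> l"
  shows "shadow x = l"
proof -
  have "terms x = f"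
    using assms(1) by (rule ext)
  then show ?thesis
    using assms(2) terms_tendsto[of x] by (metis LIMSEQ_unique)
qed

lemma hatreal_eqI: "(\<And>n. terms x n = terms y n) \<Longrightarrow> x = y"
  by transfer auto

instantiation hatreal :: comm_ring_1
begin

lift_definition zero_hatreal :: hatreal is "\<lambda>_. 0"
  by (rule convergent_const)

lift_definition one_hatreal :: hatreal is "\<lambda>_. 1"
  by (rule convergent_const)

lift_definition plus_hatreal :: "hatreal \<Rightarrow> hatreal \<Rightarrow> hatreal" is "\<lambda>x y n. x n + y n"
  by (rule convergent_add)

lift_definition uminus_hatreal :: "hatreal \<Rightarrow> hatreal" is "\<lambda>x n. - x n"
  by (simp add: convergent_minus_iff[symmetric])

lift_definition minus_hatreal :: "hatreal \<Rightarrow> hatreal \<Rightarrow> hatreal" is "\<lambda>x y n. x n - y n"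
  by (rule convergent_diff)

lift_definition times_hatreal :: "hatreal \<Rightarrow> hatreal \<Rightarrow> hatreal"
  is "\<lambda>x y n. lim x * y n + lim y * x n - lim x * lim y"
  by (intro convergent_diff convergent_add convergent_mult convergent_const)

lemma terms_simps:
  "terms 0 n = 0" "terms 1 n = 1" "terms (x + y) n = terms x n + terms y n"
  "terms (- x) n = - terms x n" "terms (x - y) n = terms x n - terms y n"
  "terms (x * y) n = shadow x * terms y n + shadow y * terms x n - shadow x * shadow y"
  by (transfer; simp)+

lemma shadow_simps:
  "shadow 0 = 0" "shadow 1 = 1" "shadow (x + y) = shadow x + shadow y"
  "shadow (- x) = - shadow x" "shadow (x - y) = shadow x - shadow y"
  "shadow (x * y) = shadow x * shadow y"
proof -
  have "(\<lambda>n. shadow x * terms y n + shadow y * terms x n - shadow x * shadow y)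
      \<longlonglongrightarrow> shadow x * shadow y + shadow y * shadow x - shadow x * shadow y"
    by (intro tendsto_intros terms_tendsto)
  then show "shadow (x * y) = shadow x * shadow y"
    by (intro shadow_eqI[OF terms_simps(6)]) simp
qed (rule shadow_eqI, rule terms_simps, intro tendsto_intros terms_tendsto)+

instance
proof
  show "(0::hatreal) \<noteq> 1"
    using shadow_simps(1,2) by force
qed (rule hatreal_eqI; simp add: terms_simps shadow_simps algebra_simps)+

end

lemma terms_const: "terms (const r) n = r"
  by transfer simp

lemma shadow_const: "shadow (const r) = r"
  by (rule shadow_eqI[OF terms_const tendsto_const])

lemma const_inject: "const r = const s \<longleftrightarrow> r = s"
  by (metis shadow_const)

lemma const_hom:
  "const 0 = 0" "const 1 = 1" "const (r + s) = const r + const s"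
  "const (- r) = - const r" "const (r - s) = const r - const s"
  "const (r * s) = const r * const s"
  by (rule hatreal_eqI; simp add: terms_simps terms_const shadow_const)+

instantiation hatreal :: order
begin

text \<open>Only the strict order carries content; \<open>\<le>\<close> is its reflexive closure. The order is not total:
  distinct elements with the same shadow are incomparable.\<close>

definition less_eq_hatreal :: "hatreal \<Rightarrow> hatreal \<Rightarrow> bool" where
  "x \<le> y \<longleftrightarrow> shadow x < shadow y \<or> x = y" for x y :: hatreal

definition less_hatreal :: "hatreal \<Rightarrow> hatreal \<Rightarrow> bool" where
  "x < y \<longleftrightarrow> shadow x < shadow y" for x y :: hatreal

instance
  by standard (auto simp: less_hatreal_def less_eq_hatreal_def)

end

text \<open>The inverse is meaningful only for units, that is, for elements with nonzero shadow.\<close>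

instantiation hatreal :: inverse
begin

definition inverse_hatreal :: "hatreal \<Rightarrow> hatreal" where
  "inverse x = (THE y. x * y = 1)" for x :: hatreal

definition divide_hatreal :: "hatreal \<Rightarrow> hatreal \<Rightarrow> hatreal" where
  "y div x = y * inverse x" for x y :: hatreal

instance ..

end

definition infinitesimal :: "hatreal \<Rightarrow> bool" where
  "infinitesimal x \<longleftrightarrow> shadow x = 0"

definition differential :: "hatreal \<Rightarrow> hatreal" where
  "differential x = x - const (shadow x)"

definition hatreal_pos :: "hatreal set" where
  "hatreal_pos = {x. 0 < x}"

text \<open>Meaningful only for positive \<open>x\<close> and \<open>m > 1\<close>.\<close>

definition hatroot :: "nat \<Rightarrow> hatreal \<Rightarrow> hatreal" where
  "hatroot m x = (THE y. y \<in> hatreal_pos \<and> y ^ m = x)"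

end

theory Submission
  imports Defs
begin

text \<open>An element is determined by its shadow and its differential, and the product of an element
  \<open>u\<close> with an infinitesimal depends on \<open>u\<close> only through \<open>shadow u\<close>. The product rule
  is therefore an identity of terms, and the rules for powers, inverses and roots follow by
  differentiating \<open>x ^ m\<close>, \<open>x * inverse x = 1\<close> and \<open>y ^ m = x\<close>. Inverses and roots exist because
  prescribing their shadow leaves a linear equation for their differential.\<close>

section \<open>Shadows, differentials and products with infinitesimals\<close>

lemma terms_differential: "terms (differential x) n = terms x n - shadow x"
  by (simp add: differential_def terms_simps terms_const)

lemma shadow_differential [simp]: "shadow (differential x) = 0"
  by (simp add: differential_def shadow_simps shadow_const)

lemma hatreal_eq_iff: "x = y \<longleftrightarrow> shadow x = shadow y \<and> differential x = differential y"
  by (metis differential_def diff_add_cancel)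

lemma shadow_power: "shadow (x ^ m) = shadow x ^ m"
  by (induction m) (simp_all add: shadow_simps)

text \<open>In the truncated product the terms of \<open>u\<close> carry the weight
  \<open>shadow e\<close>, so they vanish. This is what lets \<open>const (shadow x)\<close> and
  \<open>x\<close> replace each other in front of a differential.\<close>

lemma mult_infinitesimal_cong:
  assumes "shadow u = shadow v" and "shadow e = 0"
  shows "u * e = v * e"
  by (rule hatreal_eqI) (simp add: terms_simps assms)

lemma mult_differential_cong:
  "shadow u = shadow v \<Longrightarrow> u * differential x = v * differential x"
  by (rule mult_infinitesimal_cong) simp_all

section \<open>Differentials of sums, products and powers\<close>

lemma differential_const [simp]: "differential (const r) = 0"
  by (simp add: differential_def shadow_const)

lemma differential_1 [simp]: "differential 1 = 0"
  using differential_const[of 1] by (simp add: const_hom)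

lemma differential_add: "differential (x + y) = differential x + differential y"
  by (simp add: differential_def shadow_simps const_hom)

lemma differential_diff: "differential (x - y) = differential x - differential y"
  by (simp add: differential_def shadow_simps const_hom)

text \<open>The product is built for this: with a and b the two shadows, it expands
  \<open>(a + differential x) * (b + differential y)\<close> without the second-order term, and
  removing the shadow \<open>a * b\<close> leaves the two mixed terms.\<close>

lemma differential_mult:
  "differential (x * y) = const (shadow x) * differential y + const (shadow y) * differential x"
  by (rule hatreal_eqI)
    (simp add: terms_simps terms_differential shadow_simps shadow_const terms_const algebra_simps)

lemma const_shadow_mult_differential:
  "const (shadow u) * differential x = u * differential x"
  by (rule mult_differential_cong) (simp add: shadow_const)

lemma differential_mult': "differential (x * y) = x * differential y + y * differential x"
  by (simp add: differential_mult const_shadow_mult_differential)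

lemma differential_differential: "differential (differential x) = differential x"
  by (simp add: differential_def [of "differential x"] const_hom)

lemma differential_const_mult: "differential (const r * x) = const r * differential x"
  by (simp add: differential_mult')

lemma differential_power:
  assumes "m \<ge> 1"
  shows "differential (x ^ m) = const (real m) * x ^ (m - 1) * differential x"
  using assms
proof (induction m rule: dec_induct)
  case base
  then show ?case by (simp add: const_hom)
next
  case (step m)
  \<comment> \<open>This relies on \<open>m \<ge> 1\<close>: subtraction is truncated, and at
    \<open>m = 0\<close> the left side would be \<open>x\<close>.\<close>
  have "x * x ^ (m - 1) = x ^ m"
    using step.hyps by (simp add: power_eq_if)
  then have "x * (const (real m) * x ^ (m - 1) * differential x)
      = const (real m) * x ^ m * differential x"
    by (metis mult.assoc mult.left_commute)
  then show ?case
    by (simp add: differential_mult' step.IH const_hom algebra_simps)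
qed

section \<open>Inverses\<close>

lemma hatreal_inverse_exists:
  assumes "shadow x \<noteq> 0"
  shows "\<exists>y. x * y = 1"
proof
  let ?c = "shadow x"
  \<comment> \<open>The first-order Taylor expansion of the reciprocal at \<open>?c\<close>: its
    infinitesimal part e solves \<open>?c * e + (1 / ?c) * differential x = 0\<close>, the product
    rule applied to \<open>x * ?y = 1\<close>.\<close>
  let ?y = "const (1 / ?c) - const (1 / ?c\<^sup>2) * differential x"
  have "terms (x * ?y) n = terms 1 n" for n
    using assms
    by (simp add: terms_simps shadow_simps shadow_const terms_const terms_differential field_simps
        power2_eq_square)
  then show "x * ?y = 1"
    by (rule hatreal_eqI)
qed

lemma hatreal_right_inverse:
  assumes "shadow x \<noteq> 0"
  shows "x * inverse x = 1"
proof -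
  obtain y where y: "x * y = 1"
    using hatreal_inverse_exists[OF assms] by blast
  have "z = y" if "x * z = 1" for z
  proof -
    have "z = (x * y) * z"
      by (simp only: y mult_1_left)
    also have "\<dots> = (x * z) * y"
      by (simp only: mult_ac)
    also have "\<dots> = y"
      by (simp only: that mult_1_left)
    finally show ?thesis .
  qed
  then show ?thesis
    unfolding inverse_hatreal_def by (rule theI[of "\<lambda>y. x * y = 1", OF y])
qed

lemma shadow_inverse:
  assumes "shadow x \<noteq> 0"
  shows "shadow (inverse x) = inverse (shadow x)"
proof (rule inverse_unique[symmetric])
  show "shadow x * shadow (inverse x) = 1"
    using arg_cong[OF hatreal_right_inverse[OF assms], of shadow] by (simp only: shadow_simps)
qed

text \<open>Such an \<open>a\<close> is a unit. Being nonzero would not suffice for cancellation,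
  because the product of any two infinitesimals is 0.\<close>

lemma hatreal_mult_left_cancel:
  fixes a u v :: hatreal
  assumes "shadow a \<noteq> 0" and "a * u = a * v"
  shows "u = v"
proof -
  have "inverse a * (a * u) = inverse a * (a * v)"
    by (simp only: assms(2))
  then have "(a * inverse a) * u = (a * inverse a) * v"
    by (simp only: mult_ac)
  then show ?thesis
    by (simp only: hatreal_right_inverse[OF assms(1)] mult_1_left)
qed

lemma differential_inverse:
  assumes "shadow x \<noteq> 0"
  shows "differential (inverse x) = - (inverse x)\<^sup>2 * differential x"
proof (rule hatreal_mult_left_cancel[OF assms])
  have inv: "x * inverse x = 1"
    using assms by (rule hatreal_right_inverse)
  have "x * differential (inverse x) + inverse x * differential x = 0"
    using inv by (metis differential_mult' differential_1)
  then have "x * differential (inverse x) = - (inverse x * differential x)"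
    by (rule eq_neg_iff_add_eq_0[THEN iffD2])
  \<comment> \<open>Inserting the unit factor \<open>x * inverse x\<close> exposes a factor
    \<open>x\<close> that can be cancelled.\<close>
  also have "\<dots> = - ((x * inverse x) * inverse x * differential x)"
    by (simp add: inv)
  also have "\<dots> = x * (- (inverse x)\<^sup>2 * differential x)"
    by (simp add: power2_eq_square algebra_simps)
  finally show "x * differential (inverse x) = x * (- (inverse x)\<^sup>2 * differential x)" .
qed

section \<open>Existence, uniqueness and differentials of roots\<close>

lemma shadow_power_inject:
  assumes "shadow y > 0" "shadow z > 0" "m \<ge> 1" "y ^ m = z ^ m"
  shows "shadow y = shadow z"
proof (rule power_eq_imp_eq_base)
  show "shadow y ^ m = shadow z ^ m"
    using arg_cong[OF assms(4), of shadow] by (simp only: shadow_power)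
qed (use assms(1-3) in simp_all)

lemma hatreal_power_inject:
  assumes "shadow y > 0" "shadow z > 0" "m \<ge> 1" "y ^ m = z ^ m"
  shows "y = z"
proof -
  have eq: "shadow y = shadow z"
    using assms by (rule shadow_power_inject)
  have "const (real m) * y ^ (m - 1) * differential y = const (real m) * z ^ (m - 1) * differential z"
    by (simp only: differential_power[OF assms(3), symmetric] assms(4))
  \<comment> \<open>The coefficients in \<open>y\<close> and \<open>z\<close> have equal shadows, so
    both differentials now carry the same coefficient, which is a unit because
    \<open>shadow y > 0\<close>.\<close>
  also have "\<dots> = const (real m) * y ^ (m - 1) * differential z"
    by (rule mult_differential_cong) (simp add: shadow_simps shadow_power eq)
  finally have "differential y = differential z"
    by (rule hatreal_mult_left_cancel[rotated])
      (use assms(1,3) in \<open>simp add: shadow_simps shadow_power shadow_const\<close>)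
  with eq show ?thesis
    using hatreal_eq_iff by blast
qed

lemma hatreal_root_exists:
  assumes "shadow x > 0" "m \<ge> 1"
  shows "\<exists>y. shadow y > 0 \<and> y ^ m = x"
proof -
  define r where "r = root m (shadow x)"
  \<comment> \<open>The first-order Taylor expansion of the real m-th root at
    \<open>shadow x\<close>; the factor is the derivative of the root there and solves
    \<open>m * r ^ (m - 1) * differential y = differential x\<close>.\<close>
  define y where "y = const r + const (inverse (real m * r ^ (m - 1))) * differential x"
  have r: "r > 0" "r ^ m = shadow x"
    using assms by (simp_all add: r_def)
  have y: "shadow y = r"
    by (simp add: y_def shadow_simps shadow_const)
  have "differential (y ^ m) = const (real m * r ^ (m - 1)) * differential y"
    unfolding differential_power[OF assms(2)]
    by (rule mult_differential_cong) (simp add: shadow_simps shadow_power shadow_const y)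
  also have "\<dots> = const (real m * r ^ (m - 1) * inverse (real m * r ^ (m - 1))) * differential x"
    by (simp only: y_def differential_add differential_const differential_const_mult
        differential_differential const_hom(6) add_0 mult.assoc)
  also have "\<dots> = differential x"
    using r(1) assms(2) by (subst right_inverse) (simp_all add: const_hom)
  finally have "y ^ m = x"
    using hatreal_eq_iff by (metis shadow_power y r(2))
  with y r(1) show ?thesis
    by blast
qed

lemma mem_hatreal_pos_iff: "x \<in> hatreal_pos \<longleftrightarrow> shadow x > 0"
  by (simp add: hatreal_pos_def less_hatreal_def shadow_simps)

text \<open>Existence and uniqueness give the definite description its meaning; later facts about
  \<open>hatroot\<close> rest on these two properties alone.\<close>

lemma hatroot:
  assumes "shadow x > 0" "m \<ge> 1"
  shows shadow_hatroot_pos: "shadow (hatroot m x) > 0" and hatroot_power: "hatroot m x ^ m = x"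
proof -
  obtain y where y: "shadow y > 0" "y ^ m = x"
    using hatreal_root_exists[OF assms] by blast
  have "\<exists>!y. y \<in> hatreal_pos \<and> y ^ m = x"
  proof (rule ex1I)
    show "y \<in> hatreal_pos \<and> y ^ m = x"
      using y by (simp add: mem_hatreal_pos_iff)
    fix z
    assume "z \<in> hatreal_pos \<and> z ^ m = x"
    then show "z = y"
      by (intro hatreal_power_inject[OF _ y(1) assms(2)]) (simp_all add: mem_hatreal_pos_iff y(2))
  qed
  then have "hatroot m x \<in> hatreal_pos \<and> hatroot m x ^ m = x"
    unfolding hatroot_def by (rule theI')
  then show "shadow (hatroot m x) > 0" "hatroot m x ^ m = x"
    by (blast intro: mem_hatreal_pos_iff[THEN iffD1])+
qed

lemma shadow_hatroot:
  assumes "shadow x > 0" "m \<ge> 1"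
  shows "shadow (hatroot m x) = root m (shadow x)"
proof -
  have "shadow (hatroot m x) = root m (shadow (hatroot m x) ^ m)"
    using shadow_hatroot_pos[OF assms] assms(2) by (simp add: real_root_power_cancel)
  also have "\<dots> = root m (shadow x)"
    by (simp only: shadow_power[symmetric] hatroot_power[OF assms])
  finally show ?thesis .
qed

text \<open>The coefficient keeps a power of the root instead of the root of a power. Exchanging the
  two is left to the shadows, where it is a fact about real roots.\<close>

lemma differential_hatroot:
  assumes "shadow x > 0" "m \<ge> 1"
  shows "differential (hatroot m x)
    = inverse (const (real m) * hatroot m x ^ (m - 1)) * differential x"
proof -
  let ?a = "const (real m) * hatroot m x ^ (m - 1)"
  have "shadow ?a \<noteq> 0"
    using assms shadow_hatroot_pos[OF assms]
    by (simp add: shadow_simps shadow_power shadow_const)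
  then have inv: "?a * inverse ?a = 1"
    by (rule hatreal_right_inverse)
  have "differential x = ?a * differential (hatroot m x)"
    by (simp only: differential_power[OF assms(2), symmetric] hatroot_power[OF assms])
  then have "inverse ?a * differential x = (?a * inverse ?a) * differential (hatroot m x)"
    by (simp only: mult_ac)
  then show ?thesis
    by (simp only: inv mult_1_left)
qed

section \<open>Quotients\<close>

lemma differential_divide:
  fixes x y :: hatreal
  assumes "shadow x \<noteq> 0"
  shows "differential (y / x) = (x * differential y - y * differential x) / x ^ 2"
proof -
  have inv: "x * inverse x = 1"
    using assms by (rule hatreal_right_inverse)
  \<comment> \<open>\<open>hatreal\<close> is not a field, so the inverse of the square is
    identified by cancelling the unit \<open>x ^ 2\<close>.\<close>
  have "x\<^sup>2 * (inverse x)\<^sup>2 = 1"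
    using inv by (simp flip: power_mult_distrib)
  moreover have "x\<^sup>2 * inverse (x\<^sup>2) = 1"
    by (rule hatreal_right_inverse) (simp add: shadow_power assms)
  ultimately have "x\<^sup>2 * inverse (x\<^sup>2) = x\<^sup>2 * (inverse x)\<^sup>2"
    by simp
  then have sq: "inverse (x\<^sup>2) = (inverse x)\<^sup>2"
    by (rule hatreal_mult_left_cancel[rotated]) (simp add: shadow_power assms)
  \<comment> \<open>The extra factor \<open>x * inverse x\<close> gives both summands the common
    factor \<open>(inverse x) ^ 2\<close>.\<close>
  have "differential (y / x)
      = (x * inverse x) * inverse x * differential y - y * (inverse x)\<^sup>2 * differential x"
    by (simp add: divide_hatreal_def differential_mult' differential_inverse[OF assms] inv
        algebra_simps)
  also have "\<dots> = (x * differential y - y * differential x) / x ^ 2"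
    unfolding divide_hatreal_def sq by (simp add: power2_eq_square algebra_simps)
  finally show ?thesis .
qed

section \<open>The rules with real coefficients and with coefficients in the whole ring\<close>

theorem proposition3p6:
  shows "
    (\<forall>x y :: hatreal.
        differential (x + y) = differential x + differential y \<and>
        differential (x - y) = differential x - differential y) \<and>
    (\<forall>x y :: hatreal.
        differential (x * y) = const (shadow x) * differential y + const (shadow y) * differential x \<and>
        const (shadow x) * differential y + const (shadow y) * differential x
          = x * differential y + y * differential x) \<and>
    (\<forall>(\<xi> :: real) (x :: hatreal). differential (const \<xi> * x) = const \<xi> * differential x) \<and>
    (\<forall>(m :: nat) (x :: hatreal). m \<ge> 1 \<longrightarrow>
        differential (x ^ m) = const (real m) * const (shadow x) ^ (m - 1) * differential x \<and>
        const (real m) * const (shadow x) ^ (m - 1) * differential x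
          = const (real m) * x ^ (m - 1) * differential x) \<and>
    (\<forall>x :: hatreal. \<not> infinitesimal x \<longrightarrow>
        differential (1 / x) = - (1 / const (shadow x) ^ 2) * differential x \<and>
        - (1 / const (shadow x) ^ 2) * differential x = - (1 / x ^ 2) * differential x) \<and>
    (\<forall>x y :: hatreal. \<not> infinitesimal x \<longrightarrow>
        differential (y / x)
          = (const (shadow x) * differential y - const (shadow y) * differential x)
              / const (shadow x) ^ 2 \<and>
        (const (shadow x) * differential y - const (shadow y) * differential x)
              / const (shadow x) ^ 2
          = (x * differential y - y * differential x) / x ^ 2) \<and>
    (\<forall>(x :: hatreal) (m :: nat). x \<in> hatreal_pos \<longrightarrow> m > 1 \<longrightarrow>
        differential (hatroot m x)
          = 1 / (const (real m) * hatroot m (const (shadow x) ^ (m - 1))) * differential x \<and>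
        1 / (const (real m) * hatroot m (const (shadow x) ^ (m - 1))) * differential x
          = 1 / (const (real m) * hatroot m (x ^ (m - 1))) * differential x)"
proof (intro conjI allI impI)
  fix x y :: hatreal
  show "differential (x + y) = differential x + differential y"
    by (rule differential_add)
  show "differential (x - y) = differential x - differential y"
    by (rule differential_diff)
  show "differential (x * y) = const (shadow x) * differential y + const (shadow y) * differential x"
    by (rule differential_mult)
  show "const (shadow x) * differential y + const (shadow y) * differential x
      = x * differential y + y * differential x"
    by (simp add: const_shadow_mult_differential)
next
  fix \<xi> :: real and x :: hatreal
  show "differential (const \<xi> * x) = const \<xi> * differential x"
    by (rule differential_const_mult)
next
  fix m :: nat and x :: hatreal
  assume m: "m \<ge> 1"
  \<comment> \<open>Proved first, so that rewriting with it turns the remaining equation into the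
    known rule; inverses and quotients follow the same order.\<close>
  show eq: "const (real m) * const (shadow x) ^ (m - 1) * differential x
      = const (real m) * x ^ (m - 1) * differential x"
    by (rule mult_differential_cong) (simp add: shadow_simps shadow_power shadow_const)
  show "differential (x ^ m) = const (real m) * const (shadow x) ^ (m - 1) * differential x"
    unfolding eq using m by (rule differential_power)
next
  fix x :: hatreal
  assume "\<not> infinitesimal x"
  then have x: "shadow x \<noteq> 0"
    by (simp add: infinitesimal_def)
  show eq: "- (1 / const (shadow x) ^ 2) * differential x = - (1 / x ^ 2) * differential x"
    by (rule mult_differential_cong)
      (simp add: divide_hatreal_def shadow_simps shadow_inverse shadow_power shadow_const x)
  show "differential (1 / x) = - (1 / const (shadow x) ^ 2) * differential x"
    \<comment> \<open>The quotient rule with numerator 1, whose differential is 0.\<close>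
    unfolding eq differential_divide[OF x]
    by (simp add: divide_hatreal_def mult.commute)
next
  fix x y :: hatreal
  assume "\<not> infinitesimal x"
  then have x: "shadow x \<noteq> 0"
    by (simp add: infinitesimal_def)
  \<comment> \<open>The numerator is infinitesimal, so only the shadow of the denominator
    matters.\<close>
  have "inverse (const (shadow x) ^ 2) * (x * differential y - y * differential x)
      = inverse (x ^ 2) * (x * differential y - y * differential x)"
    by (rule mult_infinitesimal_cong)
      (simp_all add: shadow_simps shadow_inverse shadow_power shadow_const x)
  then show eq: "(const (shadow x) * differential y - const (shadow y) * differential x)
        / const (shadow x) ^ 2 = (x * differential y - y * differential x) / x ^ 2"
    by (simp add: divide_hatreal_def const_shadow_mult_differential
        mult.commute[of _ "inverse _"])
  show "differential (y / x) = (const (shadow x) * differential y - const (shadow y) * differential x)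
      / const (shadow x) ^ 2"
    unfolding eq using x by (rule differential_divide)
next
  fix x :: hatreal and m :: nat
  assume "x \<in> hatreal_pos" and "m > 1"
  then have x: "shadow x > 0" and m: "m \<ge> 1"
    by (simp_all add: mem_hatreal_pos_iff)
  \<comment> \<open>Stated for any \<open>z\<close> with this shadow in order to cover both
    radicands, \<open>const (shadow x) ^ (m - 1)\<close> and \<open>x ^ (m - 1)\<close>.\<close>
  have *: "inverse (const (real m) * hatroot m x ^ (m - 1)) * differential x
      = 1 / (const (real m) * hatroot m z) * differential x"
    if "shadow z = shadow x ^ (m - 1)" for z
  proof (rule mult_differential_cong)
    have "root m (shadow x ^ (m - 1)) = root m (shadow x) ^ (m - 1)"
      using m by (simp add: real_root_power)
    then show "shadow (inverse (const (real m) * hatroot m x ^ (m - 1)))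
        = shadow (1 / (const (real m) * hatroot m z))"
      using x m that
      by (simp add: divide_hatreal_def shadow_simps shadow_inverse shadow_power shadow_const
          shadow_hatroot)
  qed
  show d: "differential (hatroot m x)
      = 1 / (const (real m) * hatroot m (const (shadow x) ^ (m - 1))) * differential x"
    unfolding differential_hatroot[OF x m] by (rule *) (simp add: shadow_power shadow_const)
  show "1 / (const (real m) * hatroot m (const (shadow x) ^ (m - 1))) * differential x
      = 1 / (const (real m) * hatroot m (x ^ (m - 1))) * differential x"
    unfolding d[symmetric] differential_hatroot[OF x m] by (rule *) (simp add: shadow_power)
qed

end
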